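(* Let $t$ and $t'$ be constant positive integers with $t'<t$, and let $\Delta\sim\mathcal{RP}(n,t,p)$ with $$p=(1+\omega(n))\,\frac{t'\,(t-t')!\,\log n}{n^{t-t'}}$$ for some real function $\omega(n)$. If $\omega(n)\log n\to\infty$, then with high probability the $t'$-skeleton of $\Delta$ is complete. If $\omega(n)<-2\left(\frac{t}{t'}-1\right)$, then with high probability the $t'$-skeleton of $\Delta$ is not complete.
   Context: $\log$ is the natural logarithm; "with high probability" means with probability tending to $1$ as $n\to\infty$. A simplicial complex on $n$ vertices is a collection $\Delta$ of non-empty subsets (faces) of $[n]=\{1,\dots,n\}$ closed under taking non-empty subsets. For $0\le p\le 1$, the random pure simplicial complex $\Delta\sim\mathcal{RP}(n,t,p)$ is generated by choosing each subset of $[n]$ of size $t$ to be a facet of $\Delta$ independently with probability $p$, and letting $\Delta$ consist of all non-empty subsets of the chosen $t$-sets (it is implicit that $p\in[0,1]$). The $k$-skeleton of $\Delta$ is the complex of all faces of size (cardinality) at most $k$; it is complete if every non-empty subset of $[n]$ of size at most $k$ is a face of $\Delta$ (size, not dimension, is used here). *)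

theory Defs
  imports "HOL-Probability.Probability"
begin

text \<open>Simplicial complexes on the vertex set \<open>{1..n}\<close>; only non-empty faces are recorded.\<close>

definition simplicial_complex_on :: "nat \<Rightarrow> nat set set \<Rightarrow> bool" where
  "simplicial_complex_on n \<Delta> \<longleftrightarrow>
     (\<forall>\<sigma>\<in>\<Delta>. \<sigma> \<noteq> {} \<and> \<sigma> \<subseteq> {1..n} \<and> (\<forall>\<tau>. \<tau> \<noteq> {} \<longrightarrow> \<tau> \<subseteq> \<sigma> \<longrightarrow> \<tau> \<in> \<Delta>))"

definition generated_complex :: "nat set set \<Rightarrow> nat set set" where
  "generated_complex \<F> = {\<sigma>. \<sigma> \<noteq> {} \<and> (\<exists>F\<in>\<F>. \<sigma> \<subseteq> F)}"

text \<open>The index \<open>k\<close> bounds the cardinality of a face, not its dimension.\<close>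

definition skeleton :: "nat \<Rightarrow> nat set set \<Rightarrow> nat set set" where
  "skeleton k \<Delta> = {\<sigma>\<in>\<Delta>. card \<sigma> \<le> k}"

definition skeleton_complete :: "nat \<Rightarrow> nat \<Rightarrow> nat set set \<Rightarrow> bool" where
  "skeleton_complete n k \<Delta> \<longleftrightarrow>
     (\<forall>\<sigma>. \<sigma> \<noteq> {} \<and> \<sigma> \<subseteq> {1..n} \<and> card \<sigma> \<le> k \<longrightarrow> \<sigma> \<in> skeleton k \<Delta>)"

definition t_subsets :: "nat \<Rightarrow> nat \<Rightarrow> nat set set" where
  "t_subsets n t = {F. F \<subseteq> {1..n} \<and> card F = t}"

text \<open>
  The distribution \<open>RP(n,t,p)\<close>: one independent \<open>bernoulli_pmf p\<close> choice for each
  \<open>t\<close>-subset of \<open>{1..n}\<close>. It is meaningful for \<open>0 \<le> p \<le> 1\<close> only, since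
  \<open>bernoulli_pmf\<close> truncates its parameter to that interval.
\<close>

definition random_pure_complex :: "nat \<Rightarrow> nat \<Rightarrow> real \<Rightarrow> nat set set pmf" where
  "random_pure_complex n t p =
     map_pmf (\<lambda>X. generated_complex {F \<in> t_subsets n t. X F})
       (Pi_pmf (t_subsets n t) False (\<lambda>_. bernoulli_pmf p))"

definition with_high_probability :: "(nat \<Rightarrow> 'a pmf) \<Rightarrow> (nat \<Rightarrow> 'a \<Rightarrow> bool) \<Rightarrow> bool" where
  "with_high_probability M P \<longleftrightarrow>
     (\<lambda>n. measure_pmf.prob (M n) {x. P n x}) \<longlonglongrightarrow> 1"

lemma finite_t_subsets: "finite (t_subsets n t)"
  unfolding t_subsets_def by (rule finite_subset[of _ "Pow {1..n}"]) auto

lemma simplicial_complex_random_pure_complex: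
  assumes "\<Delta> \<in> set_pmf (random_pure_complex n t p)"
  shows "simplicial_complex_on n \<Delta>"
proof -
  obtain X where "\<Delta> = generated_complex {F \<in> t_subsets n t. X F}"
    using assms unfolding random_pure_complex_def set_map_pmf by blast
  then show ?thesis
    unfolding simplicial_complex_on_def generated_complex_def t_subsets_def by blast
qed

end

theory Submission
  imports Defs "HOL-Real_Asymp.Real_Asymp"
begin

text \<open>
  With \<open>d = t - t'\<close>, a \<open>t'\<close>-set is uncovered with probability \<open>q = (1 - p) ^ N\<close>, where
  \<open>N = (n - t') choose d\<close> is close to \<open>n ^ d / fact d\<close>, and the \<open>t'\<close>-skeleton is complete iff no
  \<open>t'\<close>-set is uncovered. If \<open>\<omega> n * ln n\<close> tends to infinity, the expected number of uncovered
  \<open>t'\<close>-sets tends to \<open>0\<close>. For the converse, two \<open>t'\<close>-sets are uncovered independently unless some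
  \<open>t\<close>-set contains both, and each set has at most \<open>2 ^ t * n ^ d\<close> such partners. By Chebyshev's
  inequality, all \<open>t'\<close>-sets are covered with probability at most
  \<open>2 ^ t * n ^ d / ((n choose t') * q)\<close>. The bound on \<open>\<omega>\<close> makes \<open>q\<close> at least \<open>n powr (3 * d / 2 - t')\<close>,
  so this is of order \<open>n powr (- d / 2)\<close>.
\<close>


section \<open>Counting in binomial coefficients\<close>

text \<open>The right side is the falling product \<open>m * (m - 1) * ... * (m + 1 - d)\<close>,
  whose smallest factor is \<open>m + 1 - d\<close>.\<close>

lemma pow_le_binomial_times_fact:
  assumes "d \<le> m"
  shows "(m + 1 - d) ^ d \<le> (m choose d) * fact d"
  using assms
proof (induction d)
  case (Suc d)
  have absorb: "Suc d * (m choose Suc d) = (m - d) * (m choose d)"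
    by (metis binomial_absorb_comp binomial_absorption)
  have "(m + 1 - Suc d) ^ Suc d = (m - d) * (m - d) ^ d"
    by simp
  \<comment> \<open>The base is raised by one to match the induction hypothesis; the split-off
    factor \<open>m - d\<close> is the new last factor of the falling product.\<close>
  also have "\<dots> \<le> (m - d) * (m + 1 - d) ^ d"
    by (intro mult_left_mono power_mono) auto
  also have "\<dots> \<le> (m - d) * ((m choose d) * fact d)"
    using Suc by (intro mult_left_mono) auto
  also have "\<dots> = (Suc d * (m choose Suc d)) * fact d"
    unfolding absorb by simp
  also have "\<dots> = (m choose Suc d) * fact (Suc d)"
    by (simp add: algebra_simps)
  finally show ?case .
qed simp

lemma card_supersets_of_card:
  assumes "finite A" "B \<subseteq> A" "card B \<le> k"
  shows "card {F. B \<subseteq> F \<and> F \<subseteq> A \<and> card F = k} = (card A - card B) choose (k - card B)"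
proof -
  have fin: "finite B" "\<And>F. F \<subseteq> A \<Longrightarrow> finite F"
    using assms finite_subset by blast+
  have "bij_betw (\<lambda>F. F - B) {F. B \<subseteq> F \<and> F \<subseteq> A \<and> card F = k}
          {G. G \<subseteq> A - B \<and> card G = k - card B}"
  proof (rule bij_betw_byWitness[where f' = "\<lambda>G. G \<union> B"])
    show "(\<lambda>G. G \<union> B) ` {G. G \<subseteq> A - B \<and> card G = k - card B}
        \<subseteq> {F. B \<subseteq> F \<and> F \<subseteq> A \<and> card F = k}"
    proof safe
      fix G assume G: "G \<subseteq> A - B" "card G = k - card B"
      have "G \<inter> B = {}" "finite G"
        using G(1) fin by blast+
      then show "card (G \<union> B) = k"
        using G(2) fin assms by (simp add: card_Un_disjoint)
    qed (use assms in auto)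
  qed (auto simp: card_Diff_subset fin)
  then have "card {F. B \<subseteq> F \<and> F \<subseteq> A \<and> card F = k} = card (A - B) choose (k - card B)"
    using n_subsets[of "A - B" "k - card B"] assms(1) by (simp add: bij_betw_same_card)
  then show ?thesis
    using assms fin by (simp add: card_Diff_subset)
qed

section \<open>The second moment method\<close>

text \<open>Chebyshev's inequality for the number \<open>f\<close> of events that occur. In the
  second moment the \<open>q\<close>-square terms sum to the squared mean and cancel, and each
  dependent pair adds at most \<open>q\<close>, so the variance is at most \<open>m * b * q\<close>.
  The diagonal counts as dependent: \<open>i\<close> must lie in \<open>D i\<close> unless
  \<open>q = 1\<close>.\<close>

lemma (in prob_space) prob_none_le_second_moment:
  assumes "finite I" and events: "\<And>i. i \<in> I \<Longrightarrow> E i \<in> events"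
    and prob: "\<And>i. i \<in> I \<Longrightarrow> prob (E i) = q"
    and indep: "\<And>i j. i \<in> I \<Longrightarrow> j \<in> I \<Longrightarrow> j \<notin> D i \<Longrightarrow> prob (E i \<inter> E j) = q\<^sup>2"
    and dep: "\<And>i. i \<in> I \<Longrightarrow> real (card (I \<inter> D i)) \<le> b"
    and "I \<noteq> {}" "0 < q"
  shows "prob {x \<in> space M. \<forall>i\<in>I. x \<notin> E i} \<le> b / (real (card I) * q)"
proof -
  define f :: "'a \<Rightarrow> real" where "f x = (\<Sum>i\<in>I. indicator (E i) x)" for x
  define m where "m = real (card I)"
  have m: "m > 0"
    using assms by (simp add: m_def card_gt_0_iff)
  have sq: "f x ^ 2 = (\<Sum>i\<in>I. \<Sum>j\<in>I. indicator (E i \<inter> E j) x)" for x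
    by (simp add: f_def power2_eq_square sum_product indicator_inter_arith)
  have int: "integrable M (indicator (E i) :: 'a \<Rightarrow> real)"
    "j \<in> I \<Longrightarrow> integrable M (indicator (E i \<inter> E j) :: 'a \<Rightarrow> real)" if "i \<in> I" for i j
    using that events by (auto intro!: integrable_real_indicator simp: less_top[symmetric])
  have int_f: "integrable M f" and int_sq: "integrable M (\<lambda>x. f x ^ 2)"
    unfolding sq unfolding f_def using int by (auto intro!: Bochner_Integration.integrable_sum)
  have exp_f: "expectation f = m * q"
    unfolding f_def using int events prob
    by (subst Bochner_Integration.integral_sum) (auto simp: m_def)
  \<comment> \<open>Dependent pairs satisfy the sharper bound \<open>q\<close>; the extra square
    gives all pairs a common term that sums to the squared mean.\<close>
  have pair: "prob (E i \<inter> E j) \<le> q\<^sup>2 + (if j \<in> D i then q else 0)" if "i \<in> I" "j \<in> I" for i j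
  proof (cases "j \<in> D i")
    case True
    have "prob (E i \<inter> E j) \<le> prob (E i)"
      using that events by (intro finite_measure_mono) auto
    also have "\<dots> \<le> q\<^sup>2 + q"
      using prob[OF that(1)] by simp
    finally show ?thesis using True by simp
  qed (use indep that in auto)
  have "expectation (\<lambda>x. f x ^ 2) = (\<Sum>i\<in>I. \<Sum>j\<in>I. prob (E i \<inter> E j))"
    unfolding sq using int events
    by (subst Bochner_Integration.integral_sum)
       (auto intro!: Bochner_Integration.integrable_sum sum.cong simp: Bochner_Integration.integral_sum)
  also have "\<dots> \<le> (\<Sum>i\<in>I. \<Sum>j\<in>I. q\<^sup>2 + (if j \<in> D i then q else 0))"
    by (intro sum_mono pair)
  also have "\<dots> = (\<Sum>i\<in>I. m * q\<^sup>2 + real (card (I \<inter> D i)) * q)"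
    using \<open>finite I\<close> by (simp add: sum.distrib m_def sum.If_cases Int_def)
  also have "\<dots> \<le> (\<Sum>i\<in>I. m * q\<^sup>2 + b * q)"
    using dep \<open>0 < q\<close> by (intro sum_mono add_left_mono mult_right_mono) auto
  also have "\<dots> = (m * q)\<^sup>2 + m * b * q"
    by (simp add: m_def power2_eq_square algebra_simps)
  finally have var: "variance f \<le> m * b * q"
    using variance_eq[OF int_f int_sq] exp_f by simp
  \<comment> \<open>If no event occurs then \<open>f x = 0\<close>, a deviation from the mean by the
    full mean \<open>m * q\<close>.\<close>
  have "prob {x \<in> space M. \<forall>i\<in>I. x \<notin> E i} \<le> prob {x \<in> space M. m * q \<le> \<bar>f x - expectation f\<bar>}"
  proof (rule finite_measure_mono)
    show "{x \<in> space M. m * q \<le> \<bar>f x - expectation f\<bar>} \<in> events"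
      using int_f by (intro borel_measurable_le) auto
  qed (use m \<open>0 < q\<close> in \<open>auto simp: exp_f f_def\<close>)
  also have "\<dots> \<le> variance f / (m * q)\<^sup>2"
    using int_f int_sq m \<open>0 < q\<close> by (intro Chebyshev_inequality) auto
  also have "\<dots> \<le> (m * b * q) / (m * q)\<^sup>2"
    using var by (intro divide_right_mono) auto
  also have "\<dots> = b / (m * q)"
    using m \<open>0 < q\<close> by (simp add: power2_eq_square field_simps)
  finally show ?thesis by (simp add: m_def)
qed

section \<open>Potential facets above a face\<close>

text \<open>These are the only choices that decide whether \<sigma> is covered, so faces with
  disjoint families are covered independently.\<close>

definition cofacets :: "nat \<Rightarrow> nat \<Rightarrow> nat set \<Rightarrow> nat set set" where
  "cofacets n t \<sigma> = {F \<in> t_subsets n t. \<sigma> \<subseteq> F}"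

abbreviation random_facets :: "nat \<Rightarrow> nat \<Rightarrow> real \<Rightarrow> (nat set \<Rightarrow> bool) pmf" where
  "random_facets n t p \<equiv> Pi_pmf (t_subsets n t) False (\<lambda>_. bernoulli_pmf p)"

lemma card_t_subsets: "card (t_subsets n t) = n choose t"
  using n_subsets[of "{1..n}" t] by (simp add: t_subsets_def)

lemma finite_cofacets: "finite (cofacets n t \<sigma>)"
  unfolding cofacets_def using finite_t_subsets by auto

lemma cofacets_subset: "cofacets n t \<sigma> \<subseteq> t_subsets n t"
  by (auto simp: cofacets_def)

lemma card_cofacets:
  assumes "\<sigma> \<in> t_subsets n s" "s \<le> t"
  shows "card (cofacets n t \<sigma>) = (n - s) choose (t - s)"
proof -
  have "cofacets n t \<sigma> = {F. \<sigma> \<subseteq> F \<and> F \<subseteq> {1..n} \<and> card F = t}"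
    by (auto simp: cofacets_def t_subsets_def)
  then show ?thesis
    using card_supersets_of_card[of "{1..n}" \<sigma> t] assms by (simp add: t_subsets_def)
qed

text \<open>Each partner \<tau> is a subset of some cofacet of \<sigma>. There are at most
  \<open>n ^ (t - s)\<close> cofacets, each with \<open>2 ^ t\<close> subsets; ignoring the size of
  \<tau> costs only a factor that is constant in \<open>n\<close>.\<close>

lemma card_sharing_cofacet_le:
  assumes "\<sigma> \<in> t_subsets n s" "s \<le> t"
  shows "card {\<tau> \<in> t_subsets n s. cofacets n t \<sigma> \<inter> cofacets n t \<tau> \<noteq> {}} \<le> 2 ^ t * n ^ (t - s)"
proof -
  have "{\<tau> \<in> t_subsets n s. cofacets n t \<sigma> \<inter> cofacets n t \<tau> \<noteq> {}} \<subseteq> (\<Union>F\<in>cofacets n t \<sigma>. Pow F)"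
    by (auto simp: cofacets_def)
  moreover have card_Pow_facet: "finite F \<and> card (Pow F) = 2 ^ t" if "F \<in> cofacets n t \<sigma>" for F
    using that finite_subset[of F "{1..n}"] by (auto simp: cofacets_def t_subsets_def card_Pow)
  ultimately have "card {\<tau> \<in> t_subsets n s. cofacets n t \<sigma> \<inter> cofacets n t \<tau> \<noteq> {}}
      \<le> card (\<Union>F\<in>cofacets n t \<sigma>. Pow F)"
    using finite_cofacets by (intro card_mono) auto
  also have "\<dots> \<le> (\<Sum>F\<in>cofacets n t \<sigma>. card (Pow F))"
    by (rule card_UN_le[OF finite_cofacets])
  also have "\<dots> = (\<Sum>F\<in>cofacets n t \<sigma>. 2 ^ t)"
    using card_Pow_facet by simp
  also have "\<dots> = 2 ^ t * ((n - s) choose (t - s))"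
    using card_cofacets[OF assms] by simp
  also have "(n - s) choose (t - s) \<le> ((n - s) choose (t - s)) * fact (t - s)"
    by simp
  also have "\<dots> \<le> (n - s) ^ (t - s)"
    by (rule binomial_fact_pow)
  also have "\<dots> \<le> n ^ (t - s)"
    by (intro power_mono) auto
  finally show ?thesis by simp
qed

section \<open>Probability bounds for fixed \<open>n\<close>\<close>

lemma prob_facets_avoid:
  assumes "A \<subseteq> t_subsets n t" "0 \<le> p" "p \<le> 1"
  shows "measure_pmf.prob (random_facets n t p) {X. \<forall>F\<in>A. \<not> X F} = (1 - p) ^ card A"
proof -
  \<comment> \<open>The event is a box in the product space: coordinates in \<open>A\<close> are
    forced to \<open>False\<close>, the others are free and contribute a factor 1.\<close>
  let ?B = "\<lambda>F. if F \<in> A then {False} else UNIV"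
  have eq: "{X. \<forall>F\<in>A. \<not> X F} = Pi (t_subsets n t) ?B"
    using assms(1) by (auto simp: Pi_def split: if_splits)
  have "measure_pmf.prob (random_facets n t p) {X. \<forall>F\<in>A. \<not> X F}
      = (\<Prod>F\<in>t_subsets n t. if F \<in> A then 1 - p else 1)"
    unfolding eq measure_Pi_pmf_Pi[OF finite_t_subsets] using assms
    by (intro prod.cong) (auto simp: measure_pmf_single)
  also have "\<dots> = (1 - p) ^ card (t_subsets n t \<inter> A)"
    using finite_t_subsets by (simp add: prod.If_cases Int_def)
  also have "t_subsets n t \<inter> A = A"
    using assms(1) by auto
  finally show ?thesis .
qed

lemma prob_random_pure_complex:
  "measure_pmf.prob (random_pure_complex n t p) {\<Delta>. P \<Delta>}
     = measure_pmf.prob (random_facets n t p) {X. P (generated_complex {F \<in> t_subsets n t. X F})}"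
  by (simp add: random_pure_complex_def vimage_def)

text \<open>Only faces of size exactly \<open>s\<close> matter: a smaller face extends to size
  \<open>s\<close> within \<open>{1..n}\<close>, as \<open>s \<le> n\<close>, and inherits a
  covering facet. Positivity of \<open>s\<close> makes these faces non-empty.\<close>

lemma skeleton_complete_generated_iff:
  assumes "0 < s" "s \<le> n"
  shows "skeleton_complete n s (generated_complex {F \<in> t_subsets n t. X F})
      \<longleftrightarrow> (\<forall>\<sigma>\<in>t_subsets n s. \<exists>F\<in>cofacets n t \<sigma>. X F)"
proof
  assume L: "skeleton_complete n s (generated_complex {F \<in> t_subsets n t. X F})"
  show "\<forall>\<sigma>\<in>t_subsets n s. \<exists>F\<in>cofacets n t \<sigma>. X F"
  proof
    fix \<sigma> assume "\<sigma> \<in> t_subsets n s"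
    moreover from this have "\<sigma> \<noteq> {}"
      using assms by (auto simp: t_subsets_def)
    ultimately show "\<exists>F\<in>cofacets n t \<sigma>. X F"
      using L by (auto simp: skeleton_complete_def skeleton_def generated_complex_def cofacets_def t_subsets_def)
  qed
next
  assume R: "\<forall>\<sigma>\<in>t_subsets n s. \<exists>F\<in>cofacets n t \<sigma>. X F"
  have "\<exists>F\<in>t_subsets n t. X F \<and> \<sigma> \<subseteq> F" if \<sigma>: "\<sigma> \<subseteq> {1..n}" "card \<sigma> \<le> s" for \<sigma>
  proof -
    obtain \<tau> where "\<sigma> \<subseteq> \<tau>" "\<tau> \<subseteq> {1..n}" "card \<tau> = s"
      using exists_subset_between[OF \<sigma>(2) _ \<sigma>(1)] assms(2) by auto
    moreover from this have "\<tau> \<in> t_subsets n s"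
      by (simp add: t_subsets_def)
    then obtain F where "F \<in> t_subsets n t" "\<tau> \<subseteq> F" "X F"
      using R unfolding cofacets_def by blast
    ultimately show ?thesis
      by blast
  qed
  then show "skeleton_complete n s (generated_complex {F \<in> t_subsets n t. X F})"
    by (auto simp: skeleton_complete_def skeleton_def generated_complex_def)
qed

text \<open>The union bound over all uncovered faces of size \<open>s\<close>.\<close>

lemma prob_skeleton_incomplete_le:
  assumes "0 < s" "s \<le> n" "s \<le> t" "0 \<le> p" "p \<le> 1"
  shows "measure_pmf.prob (random_pure_complex n t p) {\<Delta>. \<not> skeleton_complete n s \<Delta>}
      \<le> real (n choose s) * (1 - p) ^ ((n - s) choose (t - s))"
proof -
  let ?E = "\<lambda>\<sigma>. {X. \<forall>F\<in>cofacets n t \<sigma>. \<not> X F}"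
  have union: "{X. \<not> skeleton_complete n s (generated_complex {F \<in> t_subsets n t. X F})}
      = (\<Union>\<sigma>\<in>t_subsets n s. ?E \<sigma>)"
    unfolding skeleton_complete_generated_iff[OF assms(1,2)] by auto
  have prob: "measure_pmf.prob (random_facets n t p) (?E \<sigma>) = (1 - p) ^ ((n - s) choose (t - s))"
    if "\<sigma> \<in> t_subsets n s" for \<sigma>
    using prob_facets_avoid[OF cofacets_subset] card_cofacets[OF that] assms by simp
  have "measure_pmf.prob (random_pure_complex n t p) {\<Delta>. \<not> skeleton_complete n s \<Delta>}
      \<le> (\<Sum>\<sigma>\<in>t_subsets n s. measure_pmf.prob (random_facets n t p) (?E \<sigma>))"
    unfolding prob_random_pure_complex union
    by (rule measure_pmf.finite_measure_subadditive_finite[OF finite_t_subsets]) auto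
  also have "\<dots> = (\<Sum>\<sigma>\<in>t_subsets n s. (1 - p) ^ ((n - s) choose (t - s)))"
    by (intro sum.cong refl prob)
  finally show ?thesis
    by (simp add: card_t_subsets)
qed

text \<open>The second moment bound for the events that a face is uncovered; \<open>p < 1\<close>
  makes their probability positive.\<close>

lemma prob_skeleton_complete_le:
  assumes "0 < s" "s \<le> n" "s \<le> t" "0 \<le> p" "p < 1"
  shows "measure_pmf.prob (random_pure_complex n t p) {\<Delta>. skeleton_complete n s \<Delta>}
      \<le> 2 ^ t * real n ^ (t - s) / (real (n choose s) * (1 - p) ^ ((n - s) choose (t - s)))"
proof -
  define E where "E \<sigma> = {X. \<forall>F\<in>cofacets n t \<sigma>. \<not> X F}" for \<sigma>
  \<comment> \<open>This contains \<sigma> itself as soon as \<sigma> has a cofacet; otherwise the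
    exponent \<open>?N\<close> is 0 and the events are certain.\<close>
  define D where "D \<sigma> = {\<tau>. cofacets n t \<sigma> \<inter> cofacets n t \<tau> \<noteq> {}}" for \<sigma>
  let ?N = "(n - s) choose (t - s)"
  have "measure_pmf.prob (random_facets n t p)
        {X \<in> space (measure_pmf (random_facets n t p)). \<forall>\<sigma>\<in>t_subsets n s. X \<notin> E \<sigma>}
      \<le> 2 ^ t * real n ^ (t - s) / (real (card (t_subsets n s)) * (1 - p) ^ ?N)"
  proof (rule measure_pmf.prob_none_le_second_moment[OF finite_t_subsets])
    show "measure_pmf.prob (random_facets n t p) (E \<sigma>) = (1 - p) ^ ?N"
      if "\<sigma> \<in> t_subsets n s" for \<sigma>
      unfolding E_def using prob_facets_avoid[OF cofacets_subset] card_cofacets[OF that] assms by simp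
    show "measure_pmf.prob (random_facets n t p) (E \<sigma> \<inter> E \<tau>) = ((1 - p) ^ ?N)\<^sup>2"
      if "\<sigma> \<in> t_subsets n s" "\<tau> \<in> t_subsets n s" "\<tau> \<notin> D \<sigma>" for \<sigma> \<tau>
    proof -
      \<comment> \<open>The joint event again avoids a single family; disjointness doubles its size
        and so squares the probability.\<close>
      have "E \<sigma> \<inter> E \<tau> = {X. \<forall>F\<in>cofacets n t \<sigma> \<union> cofacets n t \<tau>. \<not> X F}"
        by (auto simp: E_def)
      moreover have "card (cofacets n t \<sigma> \<union> cofacets n t \<tau>) = ?N + ?N"
        using that assms by (subst card_Un_disjoint) (auto simp: D_def finite_cofacets card_cofacets)
      ultimately show ?thesis
        using prob_facets_avoid[of "cofacets n t \<sigma> \<union> cofacets n t \<tau>" n t p] cofacets_subset assms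
        by (simp add: power_add power2_eq_square)
    qed
    show "real (card (t_subsets n s \<inter> D \<sigma>)) \<le> 2 ^ t * real n ^ (t - s)"
      if "\<sigma> \<in> t_subsets n s" for \<sigma>
    proof -
      have "t_subsets n s \<inter> D \<sigma> = {\<tau> \<in> t_subsets n s. cofacets n t \<sigma> \<inter> cofacets n t \<tau> \<noteq> {}}"
        by (auto simp: D_def)
      then show ?thesis
        using of_nat_mono[OF card_sharing_cofacet_le[OF that assms(3)], where 'a = real] by simp
    qed
    show "t_subsets n s \<noteq> {}"
      using assms card_t_subsets[of n s] by (metis card.empty zero_less_binomial less_irrefl)
  qed (use assms in auto)
  moreover have "{X. skeleton_complete n s (generated_complex {F \<in> t_subsets n t. X F})}
      = {X. \<forall>\<sigma>\<in>t_subsets n s. X \<notin> E \<sigma>}"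
    using skeleton_complete_generated_iff[OF assms(1,2)] by (auto simp: E_def)
  ultimately show ?thesis
    unfolding prob_random_pure_complex by (simp add: card_t_subsets)
qed


section \<open>Asymptotic tools\<close>

lemma with_high_probabilityI:
  assumes "\<forall>\<^sub>F n in sequentially. measure_pmf.prob (M n) {x. \<not> P n x} \<le> g n"
    and "g \<longlonglongrightarrow> 0"
  shows "with_high_probability M P"
proof -
  have compl: "measure_pmf.prob (M n) {x. P n x} = 1 - measure_pmf.prob (M n) {x. \<not> P n x}" for n
    using measure_pmf.prob_compl[of "{x. \<not> P n x}" "M n"]
    by (simp add: Compl_eq_Diff_UNIV[symmetric] Collect_neg_eq[symmetric])
  have "(\<lambda>n. measure_pmf.prob (M n) {x. \<not> P n x}) \<longlonglongrightarrow> 0"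
    by (rule tendsto_sandwich[OF _ assms(1) tendsto_const assms(2)]) simp
  then have "(\<lambda>n. 1 - measure_pmf.prob (M n) {x. \<not> P n x}) \<longlonglongrightarrow> 1 - 0"
    by (intro tendsto_intros)
  then show ?thesis
    by (simp add: with_high_probability_def compl)
qed

lemma binomial_ratio_le_1:
  "real ((n - s) choose d) * fact d / real n ^ d \<le> 1"
proof -
  have "((n - s) choose d) * fact d \<le> n ^ d"
    using binomial_fact_pow[of "n - s" d] power_mono[of "n - s" n d] by linarith
  then have "real (((n - s) choose d) * fact d) \<le> real (n ^ d)"
    by (rule of_nat_mono)
  \<comment> \<open>For \<open>n = 0\<close> and \<open>d > 0\<close> the quotient is 0 by the
    convention for division by zero.\<close>
  then show ?thesis
    by (auto simp: divide_le_eq_1 zero_less_power_eq)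
qed

text \<open>All factors of the falling product are at least \<open>n - t\<close>, and Bernoulli's
  inequality expands the power. The explicit error of order \<open>1 / n\<close> matters: it still
  vanishes after multiplication by \<open>ln n\<close>.\<close>

lemma binomial_ratio_ge:
  assumes "s \<le> t" "t \<le> n" "0 < n"
  shows "1 - real (t - s) * real t / real n
    \<le> real ((n - s) choose (t - s)) * fact (t - s) / real n ^ (t - s)"
proof -
  let ?d = "t - s"
  have "1 + real ?d * (- (real t / real n)) \<le> (1 + - (real t / real n)) ^ ?d"
    using assms by (intro Bernoulli_inequality) simp
  also have "\<dots> = (real n - real t) ^ ?d / real n ^ ?d"
    using assms by (simp add: power_divide[symmetric] diff_divide_distrib)
  also have "\<dots> \<le> real ((n - s) choose ?d) * fact ?d / real n ^ ?d"
  proof (intro divide_right_mono)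
    have "(real n - real t) ^ ?d = real ((n - t) ^ ?d)"
      using assms by (simp add: of_nat_diff)
    \<comment> \<open>The base on the right equals \<open>n - t + 1\<close>; dropping the 1 is
      harmless.\<close>
    also have "(n - t) ^ ?d \<le> (n - s + 1 - ?d) ^ ?d"
      using assms by (intro power_mono) auto
    also have "\<dots> \<le> ((n - s) choose ?d) * fact ?d"
      using assms by (intro pow_le_binomial_times_fact) auto
    finally show "(real n - real t) ^ ?d \<le> real ((n - s) choose ?d) * fact ?d"
      by simp
  qed simp
  finally show ?thesis by simp
qed

section \<open>The two regimes of the threshold\<close>

theorem theorem6:
  fixes t t' :: nat and p \<omega> :: "nat \<Rightarrow> real"
  assumes "0 < t'" and "t' < t"
    and "\<And>n. n \<ge> 1 \<Longrightarrow>
      p n = (1 + \<omega> n) * (real t' * fact (t - t') * ln (real n) / real n ^ (t - t'))"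
    and "\<forall>\<^sub>F n in sequentially. 0 \<le> p n \<and> p n \<le> 1"
  shows "(filterlim (\<lambda>n. \<omega> n * ln (real n)) at_top sequentially \<longrightarrow>
           with_high_probability (\<lambda>n. random_pure_complex n t (p n))
             (\<lambda>n \<Delta>. skeleton_complete n t' \<Delta>)) \<and>
         ((\<forall>\<^sub>F n in sequentially. \<omega> n < - 2 * (real t / real t' - 1)) \<longrightarrow>
           with_high_probability (\<lambda>n. random_pure_complex n t (p n))
             (\<lambda>n \<Delta>. \<not> skeleton_complete n t' \<Delta>))"
proof (intro conjI impI)
  define d where "d = t - t'"
  define L where "L n = ln (real n)" for n
  define N where "N n = (n - t') choose d" for n
  \<comment> \<open>The ratio of \<open>N n\<close> to its leading term; in \<open>p n * N n\<close>
    the factorial and the power of \<open>n\<close> are absorbed into it.\<close>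
  define r where "r n = real (N n) * fact d / real n ^ d" for n
  have d: "1 \<le> d" "real d = real t - real t'"
    using assms by (auto simp: d_def)
  have p_eq: "p n = (1 + \<omega> n) * (real t' * fact d * L n / real n ^ d)" if "1 \<le> n" for n
    using assms(3)[OF that] by (simp add: d_def L_def)
  have pN: "p n * real (N n) = (1 + \<omega> n) * (real t' * L n * r n)" if "1 \<le> n" for n
    unfolding p_eq[OF that] r_def by simp
  have exp_L: "real n ^ k = exp (real k * L n)" if "1 \<le> n" for n k
    using that by (simp add: L_def exp_of_nat_mult)
  {
    assume lim: "filterlim (\<lambda>n. \<omega> n * ln (real n)) at_top sequentially"
    define \<epsilon> where "\<epsilon> n = real d * real t / real n" for n
    \<comment> \<open>The exponent is
      \<open>t' * L n - (1 + \<omega> n) * t' * L n * (1 - \<epsilon> n)\<close>, rearranged to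
      isolate the vanishing term \<open>\<epsilon> n * L n\<close> from the divergent
      \<open>\<omega> n * L n\<close>.\<close>
    define g where "g n = exp (- (real t' * (- (\<epsilon> n * L n) + (1 - \<epsilon> n) * (\<omega> n * L n))))" for n
    have \<epsilon>: "\<epsilon> \<longlonglongrightarrow> 0"
      unfolding \<epsilon>_def by real_asymp
    have \<epsilon>L: "(\<lambda>n. \<epsilon> n * L n) \<longlonglongrightarrow> 0"
      unfolding \<epsilon>_def L_def by real_asymp
    have "filterlim (\<lambda>n. (1 - \<epsilon> n) * (\<omega> n * L n)) at_top sequentially"
    proof (rule filterlim_tendsto_pos_mult_at_top)
      show "(\<lambda>n. 1 - \<epsilon> n) \<longlonglongrightarrow> 1"
        using tendsto_diff[OF tendsto_const \<epsilon>, of 1] by simp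
    qed (use lim in \<open>auto simp: L_def\<close>)
    then have "filterlim (\<lambda>n. - (\<epsilon> n * L n) + (1 - \<epsilon> n) * (\<omega> n * L n)) at_top sequentially"
      using filterlim_tendsto_add_at_top[OF tendsto_minus[OF \<epsilon>L]] by blast
    then have "filterlim (\<lambda>n. real t' * (- (\<epsilon> n * L n) + (1 - \<epsilon> n) * (\<omega> n * L n))) at_top sequentially"
      using assms(1) by (intro filterlim_tendsto_pos_mult_at_top[OF tendsto_const]) auto
    then have g: "g \<longlonglongrightarrow> 0"
      unfolding g_def using filterlim_compose[OF exp_at_bot] by (simp add: filterlim_uminus_at_top)
    \<comment> \<open>Any positive threshold would do: it yields \<open>0 \<le> \<omega> n\<close>,
      so the lower bound on \<open>r n\<close> can be multiplied by
      \<open>1 + \<omega> n\<close>.\<close>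
    have "\<forall>\<^sub>F n in sequentially. 1 \<le> \<omega> n * L n"
      using lim by (simp add: filterlim_at_top L_def)
    then have "\<forall>\<^sub>F n in sequentially. measure_pmf.prob (random_pure_complex n t (p n))
        {\<Delta>. \<not> skeleton_complete n t' \<Delta>} \<le> g n"
      using assms(4) eventually_ge_at_top[of "Suc t"]
    proof eventually_elim
      case (elim n)
      have n: "1 \<le> n" "t' \<le> n" "t' \<le> t" "t \<le> n" "0 < n"
        using elim assms by auto
      have L: "0 \<le> L n" using n by (simp add: L_def)
      have "0 \<le> \<omega> n"
        using elim(1) L by (smt (verit) mult_nonneg_nonneg mult_nonpos_nonneg)
      moreover have "1 - \<epsilon> n \<le> r n"
        unfolding \<epsilon>_def r_def N_def d_def by (rule binomial_ratio_ge) (use n in auto)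
      ultimately have "(1 + \<omega> n) * (real t' * L n * (1 - \<epsilon> n)) \<le> p n * real (N n)"
        unfolding pN[OF n(1)] using L by (intro mult_left_mono) auto
      then have exponent: "real t' * L n - p n * real (N n)
          \<le> - (real t' * (- (\<epsilon> n * L n) + (1 - \<epsilon> n) * (\<omega> n * L n)))"
        by (simp add: algebra_simps)
      have "measure_pmf.prob (random_pure_complex n t (p n)) {\<Delta>. \<not> skeleton_complete n t' \<Delta>}
          \<le> real (n choose t') * (1 - p n) ^ N n"
        unfolding N_def d_def using elim n assms(1) by (intro prob_skeleton_incomplete_le) auto
      also have "\<dots> \<le> real n ^ t' * exp (- p n) ^ N n"
      proof (intro mult_mono power_mono)
        show "real (n choose t') \<le> real n ^ t'"
          using of_nat_mono[OF binomial_le_pow[OF n(2)], where 'a = real] by simp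
        show "1 - p n \<le> exp (- p n)"
          using exp_ge_add_one_self[of "- p n"] by simp
      qed (use elim in auto)
      also have "\<dots> = exp (real t' * L n - p n * real (N n))"
        unfolding exp_L[OF n(1)] by (simp add: exp_of_nat_mult[symmetric] exp_diff exp_minus field_simps)
      also have "\<dots> \<le> g n"
        unfolding g_def using exponent by simp
      finally show ?case .
    qed
    then show "with_high_probability (\<lambda>n. random_pure_complex n t (p n))
        (\<lambda>n \<Delta>. skeleton_complete n t' \<Delta>)"
      using g by (intro with_high_probabilityI) auto
  }
  {
    assume \<omega>: "\<forall>\<^sub>F n in sequentially. \<omega> n < - 2 * (real t / real t' - 1)"
    \<comment> \<open>Multiplied by \<open>t'\<close>, the assumption on \<omega> reads
      \<open>(1 + \<omega> n) * t' < a\<close>.\<close>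
    define a where "a = real t' - 2 * real d"
    \<comment> \<open>for \<open>p \<le> c\<close> the quadratic term of \<open>ln (1 - p)\<close> costs at most a factor \<open>n powr (d / 2)\<close> in \<open>q\<close>\<close>
    define c where "c = min (1 / 2) (real d / (4 * real t'))"
    \<comment> \<open>The first factor comes from counting dependent partners, the second from
      bounding \<open>n choose t'\<close> below by \<open>(n / t') ^ t'\<close>.\<close>
    define K where "K = 2 ^ t * real t' ^ t'"
    define g where "g n = K * exp (- (real d / 2 * L n))" for n
    have "filterlim (\<lambda>n. real d / 2 * L n) at_top sequentially"
      unfolding L_def using d
      by (intro filterlim_tendsto_pos_mult_at_top[OF tendsto_const]
            filterlim_compose[OF ln_at_top filterlim_real_sequentially]) auto
    then have "(\<lambda>n. exp (- (real d / 2 * L n))) \<longlonglongrightarrow> 0"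
      using filterlim_compose[OF exp_at_bot] by (simp add: filterlim_uminus_at_top)
    then have g: "g \<longlonglongrightarrow> 0"
      unfolding g_def using tendsto_mult_right_zero by blast
    have c: "0 < c"
      using d assms(1) by (simp add: c_def)
    \<comment> \<open>This will dominate \<open>p n\<close>, since
      \<open>1 + \<omega> n \<le> 1\<close> and \<open>d \<ge> 1\<close> allow replacing
      \<open>n ^ d\<close> by \<open>n\<close>.\<close>
    have "(\<lambda>n. real t' * fact d * (ln (real n) / real n)) \<longlonglongrightarrow> real t' * fact d * 0"
      by (intro tendsto_mult_left) real_asymp
    then have "\<forall>\<^sub>F n in sequentially. real t' * fact d * (ln (real n) / real n) < c"
      using c by (intro order_tendstoD) auto
    then have "\<forall>\<^sub>F n in sequentially. measure_pmf.prob (random_pure_complex n t (p n))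
        {\<Delta>. skeleton_complete n t' \<Delta>} \<le> g n"
      using \<omega> assms(4) eventually_ge_at_top[of "t + 2"]
    proof eventually_elim
      case (elim n)
      have n: "1 \<le> n" "2 \<le> n" "t' \<le> n" "t' \<le> t"
        using elim assms by auto
      have L: "0 < L n" using n by (simp add: L_def)
      have \<omega>_less: "(1 + \<omega> n) * real t' < a"
        using elim(2) assms(1) d by (simp add: a_def field_simps)
      have "0 \<le> (1 + \<omega> n) * (real t' * fact d * L n / real n ^ d)"
        using elim(3) p_eq[OF n(1)] by simp
      moreover have "0 < real t' * fact d * L n / real n ^ d"
        using L n assms(1) by simp
      ultimately have \<omega>_ge: "0 \<le> 1 + \<omega> n"
        using zero_le_mult_iff linorder_not_less by blast
      \<comment> \<open>Positivity of \<open>a\<close> follows from \<open>0 \<le> p n\<close>. If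
        \<open>t' \<le> 2 * d\<close>, the bound on \<omega> contradicts it and the claim is
        vacuous.\<close>
      then have "0 < a"
        using \<omega>_less by (smt (verit) mult_nonneg_nonneg of_nat_0_le_iff)
      have "a \<le> real t'"
        by (simp add: a_def)
      have "(1 + \<omega> n) * real t' \<le> 1 * real t'"
        using \<omega>_less \<open>a \<le> real t'\<close> by simp
      then have \<omega>_le: "1 + \<omega> n \<le> 1"
        using assms(1) by (simp add: mult_le_cancel_right)
      have p_le: "p n \<le> c"
      proof -
        have "p n \<le> 1 * (real t' * fact d * L n / real n ^ d)"
          unfolding p_eq[OF n(1)] using \<omega>_le L by (intro mult_right_mono) auto
        also have "\<dots> \<le> real t' * fact d * L n / real n ^ 1"
          unfolding mult_1 using n L d by (intro divide_left_mono power_increasing) auto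
        finally show ?thesis
          using elim(1) by (simp add: L_def)
      qed
      have pN_le: "p n * real (N n) \<le> a * L n"
      proof -
        have "p n * real (N n) = ((1 + \<omega> n) * real t') * (L n * r n)"
          unfolding pN[OF n(1)] by simp
        also have "\<dots> \<le> a * (L n * 1)"
          using \<omega>_less L \<open>0 < a\<close> binomial_ratio_le_1[of n t' d]
          by (intro mult_mono) (auto simp: r_def N_def)
        finally show ?thesis by simp
      qed
      \<comment> \<open>Here \<open>t' - 3 / 2 * d\<close> is \<open>a + d / 2\<close>, and
        \<open>p n \<le> d / (4 * t')\<close> with \<open>a \<le> t'\<close> gives
        \<open>2 * a * p n \<le> d / 2\<close>.\<close>
      have exponent: "- (real t' - 3 / 2 * real d) * L n \<le> real (N n) * (- p n - 2 * (p n)\<^sup>2)"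
      proof -
        have "a * (2 * p n) \<le> real t' * (2 * c)"
          using \<open>a \<le> real t'\<close> p_le elim by (intro mult_mono) auto
        also have "\<dots> \<le> real t' * (2 * (real d / (4 * real t')))"
          by (intro mult_left_mono) (auto simp: c_def)
        also have "\<dots> = real d / 2"
          using assms(1) by simp
        finally have "a * (1 + 2 * p n) \<le> real t' - 3 / 2 * real d"
          by (simp add: a_def algebra_simps)
        then have "a * (1 + 2 * p n) * L n \<le> (real t' - 3 / 2 * real d) * L n"
          using L by (intro mult_right_mono) auto
        moreover have "p n * real (N n) * (1 + 2 * p n) \<le> a * L n * (1 + 2 * p n)"
          using pN_le elim by (intro mult_right_mono) auto
        ultimately show ?thesis
          by (simp add: algebra_simps power2_eq_square)
      qed
      have "exp (- (real t' - 3 / 2 * real d) * L n) \<le> exp (real (N n) * (- p n - 2 * (p n)\<^sup>2))"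
        using exponent by simp
      also have "\<dots> = exp (- p n - 2 * (p n)\<^sup>2) ^ N n"
        by (rule exp_of_nat_mult)
      also have "\<dots> \<le> (1 - p n) ^ N n"
      proof (intro power_mono)
        \<comment> \<open>This estimate holds for \<open>p n \<le> 1 / 2\<close>, which is why
          \<open>c\<close> is capped there.\<close>
        have "- p n - 2 * (p n)\<^sup>2 \<le> ln (1 - p n)"
          using elim p_le by (intro ln_one_minus_pos_lower_bound) (auto simp: c_def)
        then show "exp (- p n - 2 * (p n)\<^sup>2) \<le> 1 - p n"
          using p_le by (subst (asm) ln_ge_iff) (auto simp: c_def)
      qed simp
      finally have q_ge: "exp (- (real t' - 3 / 2 * real d) * L n) \<le> (1 - p n) ^ N n" .
      have "(real n / real t') ^ t' \<le> real (n choose t')"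
        by (rule binomial_ge_n_over_k_pow_k[OF n(3)])
      then have M_ge: "exp (real t' * L n) / real t' ^ t' \<le> real (n choose t')"
        by (simp add: power_divide exp_L[OF n(1)])
      have "measure_pmf.prob (random_pure_complex n t (p n)) {\<Delta>. skeleton_complete n t' \<Delta>}
          \<le> 2 ^ t * real n ^ d / (real (n choose t') * (1 - p n) ^ N n)"
        unfolding N_def d_def using elim n assms(1) p_le
        by (intro prob_skeleton_complete_le) (auto simp: c_def)
      also have "\<dots> \<le> 2 ^ t * real n ^ d /
          (exp (real t' * L n) / real t' ^ t' * exp (- (real t' - 3 / 2 * real d) * L n))"
        using q_ge M_ge assms(1)
        by (intro divide_left_mono mult_mono mult_pos_pos) (auto intro: less_le_trans[OF exp_gt_zero] simp: n)
      also have "\<dots> = K * (exp (real d * L n) /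
          exp (real t' * L n + - (real t' - 3 / 2 * real d) * L n))"
        unfolding exp_L[OF n(1)] exp_add K_def by simp
      \<comment> \<open>The exponents combine to
        \<open>d - t' + (t' - 3 / 2 * d) = - d / 2\<close>.\<close>
      also have "\<dots> = g n"
        unfolding g_def exp_diff[symmetric] by (simp add: algebra_simps)
      finally show ?case .
    qed
    then show "with_high_probability (\<lambda>n. random_pure_complex n t (p n))
        (\<lambda>n \<Delta>. \<not> skeleton_complete n t' \<Delta>)"
      using g by (intro with_high_probabilityI) auto
  }
qed

end
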